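(* Let $\varepsilon\in(0,1)$ be a fixed constant and let $G=G(n,p)$ be the binomial random graph with $p\gg n^{-\varepsilon}$. Then asymptotically almost surely $\chi'_{\rm OCF}(G)\le\log_2\Delta(G)+O(\ln\ln\Delta(G))=(1+o(1))\log_2\Delta(G)$.
   Context: $\Delta(G)$ denotes the maximum degree of $G$. For an edge colouring $c:E\to\mathbb{N}$ of $G=(V,E)$ (not necessarily proper) and an edge $uv$, the open neighbourhood is $E_G(uv)=(E_G(u)\cup E_G(v))\setminus\{uv\}$, where $E_G(x)$ is the set of edges incident with $x$; $uv$ is satisfied if some colour appears on exactly one edge of $E_G(uv)$. The colouring is open conflict-free if every non-isolated edge is satisfied, and $\chi'_{\rm OCF}(G)$ is the minimum number of colours of such a colouring. "Asymptotically almost surely" means with probability tending to $1$ as $n\to\infty$. *)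

theory Defs
  imports "HOL-Probability.Probability" "HOL-Library.Landau_Symbols"
begin

text \<open>A finite simple graph is a pair of a vertex set and a set of edges, each edge being a
  two-element set of vertices.\<close>

type_synonym 'a ugraph = "'a set \<times> 'a set set"

definition all_edges :: "'a set \<Rightarrow> 'a set set" where
  "all_edges V = {e. e \<subseteq> V \<and> card e = 2}"

definition incident_edges :: "'a ugraph \<Rightarrow> 'a \<Rightarrow> 'a set set" where
  "incident_edges G x = {e \<in> snd G. x \<in> e}"

text \<open>For a graph without vertices the value is unspecified.\<close>

definition max_degree :: "'a ugraph \<Rightarrow> nat" where
  "max_degree G = Max ((\<lambda>x. card (incident_edges G x)) ` fst G)"

definition open_edge_nbhd :: "'a ugraph \<Rightarrow> 'a set \<Rightarrow> 'a set set" where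
  "open_edge_nbhd G e = (\<Union>x\<in>e. incident_edges G x) - {e}"

definition satisfied :: "'a ugraph \<Rightarrow> ('a set \<Rightarrow> nat) \<Rightarrow> 'a set \<Rightarrow> bool" where
  "satisfied G c e \<longleftrightarrow> (\<exists>col. \<exists>!f. f \<in> open_edge_nbhd G e \<and> c f = col)"

definition isolated_edge :: "'a ugraph \<Rightarrow> 'a set \<Rightarrow> bool" where
  "isolated_edge G e \<longleftrightarrow> e \<in> snd G \<and> open_edge_nbhd G e = {}"

definition ocf_colouring :: "'a ugraph \<Rightarrow> ('a set \<Rightarrow> nat) \<Rightarrow> bool" where
  "ocf_colouring G c \<longleftrightarrow> (\<forall>e\<in>snd G. \<not> isolated_edge G e \<longrightarrow> satisfied G c e)"

text \<open>Colourings are total functions, but only their values on edges matter; the number of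
  colours is the number of colours occurring on edges.\<close>

definition ocf_index :: "'a ugraph \<Rightarrow> nat" where
  "ocf_index G = (LEAST k. \<exists>c. ocf_colouring G c \<and> card (c ` snd G) = k)"

text \<open>The minimum in \<^const>\<open>ocf_index\<close> is attained whenever there are finitely many edges.\<close>

lemma ocf_colouring_exists:
  assumes "finite (snd G)"
  shows "\<exists>c. ocf_colouring G c"
proof -
  obtain c :: "'a set \<Rightarrow> nat" where c: "inj_on c (snd G)"
    using finite_imp_inj_to_nat_seg[OF assms] by blast
  have "satisfied G c e" if "e \<in> snd G" "\<not> isolated_edge G e" for e
  proof -
    obtain f where f: "f \<in> open_edge_nbhd G e"
      using \<open>e \<in> snd G\<close> \<open>\<not> isolated_edge G e\<close> by (auto simp: isolated_edge_def)
    have sub: "open_edge_nbhd G e \<subseteq> snd G"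
      by (auto simp: open_edge_nbhd_def incident_edges_def)
    have "\<exists>!g. g \<in> open_edge_nbhd G e \<and> c g = c f"
      using f sub inj_onD[OF c] by blast
    then show ?thesis
      unfolding satisfied_def by blast
  qed
  then show ?thesis
    unfolding ocf_colouring_def by blast
qed

text \<open>The binomial random graph: each pair of vertices is an edge independently with
  probability \<open>p\<close>. (\<^const>\<open>bernoulli_pmf\<close> clips its argument to the unit interval.)\<close>

definition gnp :: "nat \<Rightarrow> real \<Rightarrow> nat ugraph pmf" where
  "gnp n p = map_pmf (\<lambda>b. ({..<n}, {e \<in> all_edges {..<n}. b e}))
     (Pi_pmf (all_edges {..<n}) False (\<lambda>_. bernoulli_pmf p))"

definition asymp_almost_surely :: "(nat \<Rightarrow> 'g pmf) \<Rightarrow> (nat \<Rightarrow> 'g \<Rightarrow> bool) \<Rightarrow> bool" where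
  "asymp_almost_surely \<G> P \<longleftrightarrow>
     (\<lambda>n. measure_pmf.prob (\<G> n) {G. P n G}) \<longlonglongrightarrow> 1"

end

theory Submission
  imports Defs "HOL-Real_Asymp.Real_Asymp"
begin

text \<open>
  Split the vertices into four fixed parts \<open>P\<^sub>0, \<dots>, P\<^sub>3\<close>, where \<open>P\<^sub>1\<close>, \<open>P\<^sub>3\<close> (and \<open>P\<^sub>0\<close>) have
  about \<open>(ln n)\<^sup>2 / p\<close> vertices. With high probability every vertex of \<open>P\<^sub>r\<close> has at least
  \<open>3 ln n\<close> neighbours in \<open>P\<^bsub>r+1 mod 4\<^esub>\<close>, while \<open>P\<^sub>1 \<union> P\<^sub>3\<close> induces a graph of maximum degree
  \<open>O((ln n)\<^sup>2)\<close>. Give each vertex of \<open>P\<^sub>r\<close> a label, a set of colours consisting of \<open>r\<close> and of the bits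
  of a greedy proper vertex colouring of \<open>P\<^sub>0 \<union> P\<^sub>2\<close> (respectively \<open>P\<^sub>1 \<union> P\<^sub>3\<close>); the first needs
  \<open>log\<^sub>2 \<Delta> + O(1)\<close> bits, the second only \<open>O(ln ln n)\<close>. Every vertex of \<open>P\<^sub>r\<close> realises each colour of
  its label on one private edge into \<open>P\<^bsub>r+1 mod 4\<^esub>\<close>; all other edges get a common default colour.
  An edge inside \<open>P\<^sub>0 \<union> P\<^sub>2\<close> or \<open>P\<^sub>1 \<union> P\<^sub>3\<close> is satisfied by a bit in which the labels of its ends differ,
  and an edge between \<open>P\<^sub>r\<close> and \<open>P\<^bsub>r+1 mod 4\<^esub>\<close> by the colour \<open>r + 1 mod 4\<close>, which its end in \<open>P\<^sub>r\<close> does not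
  see. Finally \<open>\<Delta> \<ge> n\<^sup>\<delta>\<close> for a constant \<open>\<delta> > 0\<close>, so \<open>ln ln n\<close> is of the order of \<open>ln ln \<Delta>\<close>.
\<close>

section \<open>Greedy vertex colouring and degrees\<close>

text \<open>Vertices are added one at a time: the new one has fewer neighbours than \<open>P\<close>
  has elements, so some element of \<open>P\<close> is free for it. The palette is an arbitrary set
  so that it can later be a power set, a colour then being a set of bits.\<close>

lemma greedy_colouring:
  fixes R :: "'a \<Rightarrow> 'a \<Rightarrow> bool"
  assumes "finite V" and sym: "\<And>u v. R u v \<Longrightarrow> R v u" and irr: "\<And>v. \<not> R v v"
    and "\<And>v. v \<in> V \<Longrightarrow> card {u \<in> V. R v u} < card P"
  shows "\<exists>g. g ` V \<subseteq> P \<and> (\<forall>u\<in>V. \<forall>v\<in>V. R u v \<longrightarrow> g u \<noteq> g v)"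
  using assms(1,4)
proof (induction V)
  case empty
  then show ?case by auto
next
  case (insert x V)
  have "card {u \<in> V. R v u} < card P" if "v \<in> V" for v
  proof -
    have "card {u \<in> V. R v u} \<le> card {u \<in> insert x V. R v u}"
      using insert.hyps by (intro card_mono) auto
    also have "\<dots> < card P" using insert.prems that by auto
    finally show ?thesis .
  qed
  from insert.IH[OF this] obtain g where
    g: "g ` V \<subseteq> P" "\<And>u v. u \<in> V \<Longrightarrow> v \<in> V \<Longrightarrow> R u v \<Longrightarrow> g u \<noteq> g v"
    by blast
  have "card (g ` {u \<in> V. R x u}) \<le> card {u \<in> insert x V. R x u}"
    using insert.hyps by (intro order_trans[OF card_image_le] card_mono) auto
  also have "\<dots> < card P" using insert.prems by auto
  finally have "\<not> P \<subseteq> g ` {u \<in> V. R x u}"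
    using insert.hyps card_mono[of "g ` {u \<in> V. R x u}" P] by auto
  then obtain k where k: "k \<in> P" "\<And>u. u \<in> V \<Longrightarrow> R x u \<Longrightarrow> g u \<noteq> k" by blast
  show ?case
  proof (intro exI[of _ "g(x := k)"] conjI ballI impI)
    show "(g(x := k)) ` insert x V \<subseteq> P" using g(1) k(1) by auto
  next
    fix u v assume uv: "u \<in> insert x V" "v \<in> insert x V" "R u v"
    show "(g(x := k)) u \<noteq> (g(x := k)) v"
      using uv g(2)[of u v] k(2)[of u] k(2)[of v] sym[OF uv(3)] irr[of x]
      by (cases "u = x"; cases "v = x") auto
  qed
qed

definition neighbours :: "'a ugraph \<Rightarrow> 'a \<Rightarrow> 'a set" where
  "neighbours G v = {u \<in> fst G. {v, u} \<in> snd G}"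

lemma card_incident_edges:
  assumes "snd G \<subseteq> all_edges (fst G)"
  shows "card (incident_edges G v) = card (neighbours G v)"
proof -
  have "incident_edges G v = (\<lambda>u. {v, u}) ` neighbours G v"
  proof
    show "incident_edges G v \<subseteq> (\<lambda>u. {v, u}) ` neighbours G v"
    proof
      fix e assume e: "e \<in> incident_edges G v"
      then have "e \<subseteq> fst G" "card e = 2" "v \<in> e" "e \<in> snd G"
        using assms by (auto simp: incident_edges_def all_edges_def)
      moreover from this obtain u where "e = {v, u}" by (auto simp: card_2_iff)
      ultimately show "e \<in> (\<lambda>u. {v, u}) ` neighbours G v"
        by (auto simp: neighbours_def)
    qed
  qed (auto simp: incident_edges_def neighbours_def)
  moreover have "inj_on (\<lambda>u. {v, u}) (neighbours G v)"
    by (auto simp: inj_on_def doubleton_eq_iff)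
  ultimately show ?thesis by (simp add: card_image)
qed

lemma card_neighbours_le_max_degree:
  assumes "snd G \<subseteq> all_edges (fst G)" "finite (fst G)" "v \<in> fst G"
  shows "card (neighbours G v) \<le> max_degree G"
  unfolding max_degree_def card_incident_edges[OF assms(1)]
  using assms(2,3) by (intro Max_ge) auto

lemma max_degree_le_card:
  assumes "snd G \<subseteq> all_edges (fst G)" "finite (fst G)" "fst G \<noteq> {}"
  shows "max_degree G \<le> card (fst G)"
  unfolding max_degree_def card_incident_edges[OF assms(1)] neighbours_def
  using assms(2,3) by (auto intro!: card_mono)

section \<open>From vertex labels to open conflict-free colourings\<close>

text \<open>Here \<open>r v\<close> is the index of the part of \<open>v\<close>, and \<open>{v, f v k}\<close> is the private edge on which \<open>v\<close> realises
  the colour \<open>k\<close> of its label \<open>L v\<close>.\<close>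

lemma ocf_colouring_of_labelling:
  fixes G :: "'a ugraph" and r :: "'a \<Rightarrow> nat" and L :: "'a \<Rightarrow> nat set"
    and f :: "'a \<Rightarrow> nat \<Rightarrow> 'a"
  assumes edges: "snd G \<subseteq> all_edges (fst G)"
    and r4: "\<And>v. v \<in> fst G \<Longrightarrow> r v < 4"
    and f: "\<And>v k. v \<in> fst G \<Longrightarrow> k \<in> L v \<Longrightarrow>
        {v, f v k} \<in> snd G \<and> r (f v k) = (r v + 1) mod 4"
    and inj: "\<And>v. v \<in> fst G \<Longrightarrow> inj_on (f v) (L v)"
    and own: "\<And>v. v \<in> fst G \<Longrightarrow> L v \<inter> {..<4} = {r v}"
    and disj: "\<And>u v. u \<in> fst G \<Longrightarrow> v \<in> fst G \<Longrightarrow> even (r u) \<noteq> even (r v) \<Longrightarrow>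
        L u \<inter> L v = {}"
    and proper: "\<And>u v. {u, v} \<in> snd G \<Longrightarrow> even (r u) = even (r v) \<Longrightarrow> L u \<noteq> L v"
    and d: "\<And>v. v \<in> fst G \<Longrightarrow> d \<notin> L v"
  shows "\<exists>c. ocf_colouring G c \<and> c ` snd G \<subseteq> insert d (\<Union>v\<in>fst G. L v)"
proof -
  define V E where "V = fst G" and "E = snd G"
  note defs = V_def[symmetric] E_def[symmetric]
  note assms' = assms[unfolded defs]
  have fV: "f v k \<in> V" if "v \<in> V" "k \<in> L v" for v k
    using assms'(1) assms'(3)[OF that] by (auto simp: all_edges_def)
  have par: "even (r (f v k)) \<noteq> even (r v)" if "v \<in> V" "k \<in> L v" for v k
  proof -
    have "r v < 4" "r (f v k) = (r v + 1) mod 4" using assms'(2,3) that by auto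
    then show ?thesis by presburger
  qed
  define pick where "pick e k \<longleftrightarrow> (\<exists>v\<in>V. k \<in> L v \<and> e = {v, f v k})" for e k
  \<comment> \<open>An edge cannot be private to both its ends, since then each index would be the
    successor of the other and 2 would vanish modulo 4. For a single owner, injectivity of
    \<open>f v\<close> determines the colour.\<close>
  have pick_unique: "k = k'" if picks: "pick e k" "pick e k'" for e k k'
  proof -
    obtain v v' where v: "v \<in> V" "k \<in> L v" "e = {v, f v k}"
      and v': "v' \<in> V" "k' \<in> L v'" "e = {v', f v' k'}"
      using picks unfolding pick_def by metis
    have "v = v'"
    proof (rule ccontr)
      assume "v \<noteq> v'"
      then have "v = f v' k'" "v' = f v k" using v v' by (metis doubleton_eq_iff)+
      then have "r v = (r v' + 1) mod 4" "r v' = (r v + 1) mod 4" "r v < 4"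
        using v v' assms'(2,3) by metis+
      then show False by presburger
    qed
    then show ?thesis using v v' assms'(4)[OF v(1)]
      by (metis doubleton_eq_iff inj_onD)
  qed
  define c where "c e = (if \<exists>k. pick e k then THE k. pick e k else d)" for e
  have c_eq: "c e = k" if "pick e k" for e k
  proof -
    have "(THE k. pick e k) = k"
      using that pick_unique by (intro the_equality) auto
    then show ?thesis using that by (auto simp: c_def)
  qed
  have pickL: "\<exists>v\<in>V. k \<in> L v" if "pick e k" for e k using that by (auto simp: pick_def)
  have c_iff: "c e = k \<longleftrightarrow> pick e k" if "k \<noteq> d" for e k
    using that c_eq by (metis c_def)
  \<comment> \<open>The satisfaction criterion: colour \<open>k\<close> appears around
    \<open>uv\<close> exactly once, on the private edge of \<open>u\<close>. The last three
    conditions say that \<open>v\<close> owns no such edge, that the edge is not \<open>uv\<close>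
    itself, and that no private edge of colour \<open>k\<close> ends at \<open>u\<close> or
    \<open>v\<close> from outside.\<close>
  have sat: "satisfied G c {u, v}"
    if uv: "{u, v} \<in> E" "u \<in> V" "v \<in> V" "k \<in> L u" "k \<notin> L v" "f u k \<noteq> v"
      "\<And>w. w \<in> V \<Longrightarrow> k \<in> L w \<Longrightarrow> f w k \<noteq> u \<and> f w k \<noteq> v" for u v k
  proof -
    have kd: "k \<noteq> d" using uv assms'(8) by auto
    have "u \<noteq> v" using uv by auto
    have "\<exists>!e. e \<in> open_edge_nbhd G {u, v} \<and> c e = k"
    proof (rule ex1I[of _ "{u, f u k}"])
      show "{u, f u k} \<in> open_edge_nbhd G {u, v} \<and> c {u, f u k} = k"
        using uv assms'(3)[of u k] c_eq[of "{u, f u k}" k]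
        by (auto simp: open_edge_nbhd_def incident_edges_def defs pick_def doubleton_eq_iff)
    next
      fix e assume e: "e \<in> open_edge_nbhd G {u, v} \<and> c e = k"
      then have "pick e k" using c_iff[OF kd] by auto
      then obtain w where w: "w \<in> V" "k \<in> L w" "e = {w, f w k}" by (auto simp: pick_def)
      have "u \<in> e \<or> v \<in> e" using e by (auto simp: open_edge_nbhd_def incident_edges_def)
      then show "e = {u, f u k}" using w uv by auto
    qed
    then show ?thesis by (auto simp: satisfied_def)
  qed
  have succ: "k \<noteq> i \<and> k \<noteq> j" if "k = (j + 1) mod 4" "j = (i + 1) mod 4" "i < 4" for i j k :: nat
    using that by presburger
  \<comment> \<open>Colours below 4 lie only in labels of their own part. Hence private edges of
    colour \<open>r v\<close> lead from part \<open>r v\<close> to its successor, which contains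
    neither \<open>u\<close> nor \<open>v\<close>, and the criterion applies with the roles of
    \<open>u\<close> and \<open>v\<close> exchanged.\<close>
  have sat': "satisfied G c {u, v}"
    if uv: "{u, v} \<in> E" "u \<in> V" "v \<in> V" "r v = (r u + 1) mod 4" for u v
  proof -
    have "r v \<in> L v" "r u < 4" "r v < 4" using assms'(5)[of v] assms'(2) uv by auto
    have rL: "k \<in> L w \<Longrightarrow> w \<in> V \<Longrightarrow> k < 4 \<Longrightarrow> k = r w" for k w using assms'(5)[of w] by blast
    have "satisfied G c {v, u}"
    proof (rule sat[of v u "r v"])
      show "{v, u} \<in> E" using uv by (simp add: insert_commute)
      show "r v \<notin> L u" using rL[of "r v" u] uv \<open>r v < 4\<close> by auto presburger
      show "f v (r v) \<noteq> u"
      proof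
        assume "f v (r v) = u"
        then have "r u = (r v + 1) mod 4" using assms'(3)[of v "r v"] \<open>r v \<in> L v\<close> uv by auto
        then show False using uv \<open>r u < 4\<close> by presburger
      qed
    next
      fix w assume w: "w \<in> V" "r v \<in> L w"
      then have "r w = r v" using rL[of "r v" w] \<open>r v < 4\<close> by auto
      then have "r (f w (r v)) = (r v + 1) mod 4" using assms'(3)[of w "r v"] w by auto
      then have "r (f w (r v)) \<noteq> r u" "r (f w (r v)) \<noteq> r v" 
        using uv \<open>r u < 4\<close> succ by blast+
      then show "f w (r v) \<noteq> v \<and> f w (r v) \<noteq> u" by auto
    qed (use uv \<open>r v \<in> L v\<close> in auto)
    then show ?thesis by (simp add: insert_commute)
  qed
  \<comment> \<open>By \<open>disj\<close>, every owner of \<open>k\<close> has the parity of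
    \<open>u\<close> and \<open>v\<close>, and private edges change parity; so none of colour
    \<open>k\<close> ends at \<open>u\<close> or \<open>v\<close>.\<close>
  have sat'': "satisfied G c {u, v}"
    if uv: "{u, v} \<in> E" "u \<in> V" "v \<in> V" "even (r u) = even (r v)" "k \<in> L u" "k \<notin> L v" for u v k
  proof (rule sat[of u v k])
    show "f u k \<noteq> v" using par[of u k] uv by auto
  next
    fix w assume w: "w \<in> V" "k \<in> L w"
    then have "even (r u) = even (r w)" using assms'(6)[of u w] uv by blast
    then show "f w k \<noteq> u \<and> f w k \<noteq> v" using par[OF w] uv by auto
  qed (use uv in auto)
  have "satisfied G c e" if eE: "e \<in> E" for e
  proof -
    obtain u v where e: "e = {u, v}" "u \<in> V" "v \<in> V"
      using eE assms'(1) by (auto simp: all_edges_def card_2_iff)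
    have comm: "{v, u} = e" using e by auto
    show ?thesis
    proof (cases "even (r u) = even (r v)")
      case True
      then have "L u \<noteq> L v" using assms'(7)[of u v] eE e by auto
      then obtain k where "k \<in> L u \<and> k \<notin> L v \<or> k \<in> L v \<and> k \<notin> L u" by auto
      then show ?thesis using sat''[of u v k] sat''[of v u k] eE e comm True by auto
    next
      case False
      \<comment> \<open>Modulo 4, indices of opposite parity are cyclically consecutive, so the two
        cases cover all edges.\<close>
      have "r u \<in> {0, 1, 2, 3}" "r v \<in> {0, 1, 2, 3}"
        using assms'(2)[OF e(2)] assms'(2)[OF e(3)] by auto
      then have "r v = (r u + 1) mod 4 \<or> r u = (r v + 1) mod 4" using False by auto
      then show ?thesis
        using sat'[of u v] sat'[of v u] eE e(2,3) unfolding comm e(1)[symmetric] by blast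
    qed
  qed
  then have "ocf_colouring G c" by (auto simp: ocf_colouring_def defs)
  moreover have "c ` E \<subseteq> insert d (\<Union>v\<in>V. L v)"
    using c_iff pickL by blast
  ultimately show ?thesis by (auto simp: defs)
qed

lemma ocf_index_le:
  assumes "ocf_colouring G c" "c ` snd G \<subseteq> A" "finite A"
  shows "ocf_index G \<le> card A"
proof -
  have "ocf_index G \<le> card (c ` snd G)"
    unfolding ocf_index_def using assms by (intro Least_le) auto
  also have "\<dots> \<le> card A" using assms by (intro card_mono)
  finally show ?thesis .
qed

text \<open>Greedy colouring by subsets of \<open>K\<close> (respectively \<open>m\<close>) bits
  gives adjacent vertices of equal parity different labels. A label has at most
  \<open>max K m + 1\<close> elements, and the hypothesis \<open>many\<close> supplies distinct ends
  for its private edges.\<close>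

lemma ocf_index_le_of_cyclic_partition:
  fixes G :: "'a ugraph" and r :: "'a \<Rightarrow> nat" and K m :: nat
  assumes edges: "snd G \<subseteq> all_edges (fst G)" and fin: "finite (fst G)"
    and r4: "\<And>v. v \<in> fst G \<Longrightarrow> r v < 4"
    and many: "\<And>v. v \<in> fst G \<Longrightarrow>
      max K m + 1 \<le> card {u \<in> neighbours G v. r u = (r v + 1) mod 4}"
    and even_deg: "\<And>v. v \<in> fst G \<Longrightarrow> even (r v) \<Longrightarrow>
      card {u \<in> neighbours G v. even (r u)} < 2 ^ K"
    and odd_deg: "\<And>v. v \<in> fst G \<Longrightarrow> odd (r v) \<Longrightarrow>
      card {u \<in> neighbours G v. odd (r u)} < 2 ^ m"
  shows "ocf_index G \<le> K + m + 5"
proof -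
  \<comment> \<open>Colours 0 to 3 are the part indices and 4 is the default, so the bits start at
    5; this accounts for the summand 5 in the bound.\<close>
  define A B where "A = {5..<5 + K}" and "B = {5 + K..<5 + K + m}"
  have adj: "{u, v} \<in> snd G \<Longrightarrow> {v, u} \<in> snd G" for u v by (simp add: insert_commute)
  have irr: "{v} \<notin> snd G" for v using edges by (auto simp: all_edges_def)
  have "\<exists>g. g ` {v \<in> fst G. even (r v)} \<subseteq> Pow A \<and>
      (\<forall>u\<in>{v \<in> fst G. even (r v)}. \<forall>v\<in>{v \<in> fst G. even (r v)}. {u, v} \<in> snd G \<longrightarrow> g u \<noteq> g v)"
  proof (rule greedy_colouring)
    fix v assume "v \<in> {v \<in> fst G. even (r v)}"
    moreover have "{u \<in> {v \<in> fst G. even (r v)}. {v, u} \<in> snd G} = {u \<in> neighbours G v. even (r u)}"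
      by (auto simp: neighbours_def)
    ultimately show "card {u \<in> {v \<in> fst G. even (r v)}. {v, u} \<in> snd G} < card (Pow A)"
      using even_deg by (simp add: card_Pow A_def)
  qed (use fin adj irr in auto)
  then obtain g where "g ` {v \<in> fst G. even (r v)} \<subseteq> Pow A"
    "\<forall>u\<in>{v \<in> fst G. even (r v)}. \<forall>v\<in>{v \<in> fst G. even (r v)}. {u, v} \<in> snd G \<longrightarrow> g u \<noteq> g v"
    by blast
  then have g: "\<And>v. v \<in> fst G \<Longrightarrow> even (r v) \<Longrightarrow> g v \<subseteq> A"
    "\<And>u v. u \<in> fst G \<Longrightarrow> v \<in> fst G \<Longrightarrow> even (r u) \<Longrightarrow> even (r v) \<Longrightarrow> {u, v} \<in> snd G \<Longrightarrow> g u \<noteq> g v"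
    by (simp_all add: image_subset_iff)
  have "\<exists>h. h ` {v \<in> fst G. odd (r v)} \<subseteq> Pow B \<and>
      (\<forall>u\<in>{v \<in> fst G. odd (r v)}. \<forall>v\<in>{v \<in> fst G. odd (r v)}. {u, v} \<in> snd G \<longrightarrow> h u \<noteq> h v)"
  proof (rule greedy_colouring)
    fix v assume "v \<in> {v \<in> fst G. odd (r v)}"
    moreover have "{u \<in> {v \<in> fst G. odd (r v)}. {v, u} \<in> snd G} = {u \<in> neighbours G v. odd (r u)}"
      by (auto simp: neighbours_def)
    ultimately show "card {u \<in> {v \<in> fst G. odd (r v)}. {v, u} \<in> snd G} < card (Pow B)"
      using odd_deg by (simp add: card_Pow B_def)
  qed (use fin adj irr in auto)
  then obtain h where "h ` {v \<in> fst G. odd (r v)} \<subseteq> Pow B"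
    "\<forall>u\<in>{v \<in> fst G. odd (r v)}. \<forall>v\<in>{v \<in> fst G. odd (r v)}. {u, v} \<in> snd G \<longrightarrow> h u \<noteq> h v"
    by blast
  then have h: "\<And>v. v \<in> fst G \<Longrightarrow> odd (r v) \<Longrightarrow> h v \<subseteq> B"
    "\<And>u v. u \<in> fst G \<Longrightarrow> v \<in> fst G \<Longrightarrow> odd (r u) \<Longrightarrow> odd (r v) \<Longrightarrow> {u, v} \<in> snd G \<Longrightarrow> h u \<noteq> h v"
    by (simp_all add: image_subset_iff)
  define b where "b v = (if even (r v) then g v else h v)" for v
  define L where "L v = insert (r v) (b v)" for v
  have b5: "x \<ge> 5" if "v \<in> fst G" "x \<in> b v" for v x
    using that g(1)[of v] h(1)[of v] by (auto simp: b_def A_def B_def split: if_splits)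
  have cardL: "card (L v) \<le> max K m + 1" "finite (L v)" if v: "v \<in> fst G" for v
  proof -
    have "b v \<subseteq> A \<or> b v \<subseteq> B" using g(1)[OF v] h(1)[OF v] by (auto simp: b_def)
    then have "card (b v) \<le> card A \<or> card (b v) \<le> card B" and fb: "finite (b v)"
      by (auto intro: card_mono finite_subset simp: A_def B_def simp del: card_atLeastLessThan)
    then have "card (b v) \<le> max K m" by (auto simp: A_def B_def)
    then show "finite (L v)" "card (L v) \<le> max K m + 1"
      using fb by (auto simp: L_def card_insert_if)
  qed
  have "\<exists>f. f ` L v \<subseteq> {u \<in> neighbours G v. r u = (r v + 1) mod 4} \<and> inj_on f (L v)"
    if "v \<in> fst G" for v
    using that cardL many[OF that] fin
    by (intro card_le_inj) (auto simp: neighbours_def intro: order_trans)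
  then obtain f where f: "\<And>v. v \<in> fst G \<Longrightarrow>
      f v ` L v \<subseteq> {u \<in> neighbours G v. r u = (r v + 1) mod 4} \<and> inj_on (f v) (L v)"
    by metis
  have "\<exists>c. ocf_colouring G c \<and> c ` snd G \<subseteq> insert 4 (\<Union>v\<in>fst G. L v)"
  proof (rule ocf_colouring_of_labelling[of G r L f])
    fix v assume v: "v \<in> fst G"
    show "L v \<inter> {..<4} = {r v}" using b5[OF v] r4[OF v] by (force simp: L_def)
    show "4 \<notin> L v" using b5[OF v, of 4] r4[OF v] by (auto simp: L_def)
    show "inj_on (f v) (L v)" using f[OF v] by auto
    show "{v, f v k} \<in> snd G \<and> r (f v k) = (r v + 1) mod 4" if "k \<in> L v" for k
      using f[OF v] that by (auto simp: neighbours_def)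
  next
    fix u v assume uv: "u \<in> fst G" "v \<in> fst G" "even (r u) \<noteq> even (r v)"
    have "b u \<inter> b v = {}"
      using uv g(1)[of u] h(1)[of u] g(1)[of v] h(1)[of v]
      by (auto simp: b_def A_def B_def split: if_splits) fastforce+
    then show "L u \<inter> L v = {}"
      using uv b5[of u "r v"] b5[of v "r u"] r4[of u] r4[of v] by (auto simp: L_def)
  next
    fix u v assume uv: "{u, v} \<in> snd G" "even (r u) = even (r v)"
    then have V: "u \<in> fst G" "v \<in> fst G" using edges by (auto simp: all_edges_def)
    then have "b u \<noteq> b v" using g(2)[of u v] h(2)[of u v] uv by (auto simp: b_def)
    \<comment> \<open>Cutting off the part index recovers the bit set, so different bit sets force
      different labels.\<close>
    moreover have "b w = L w \<inter> {5..}" if "w \<in> fst G" for w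
      using b5[OF that] r4[OF that] by (auto simp: L_def)
    ultimately show "L u \<noteq> L v" using V by metis
  qed (use edges r4 in auto)
  then obtain c where c: "ocf_colouring G c" "c ` snd G \<subseteq> insert 4 (\<Union>v\<in>fst G. L v)" by auto
  have "L v \<subseteq> {..<K + m + 5}" if "v \<in> fst G" for v
    using g(1)[OF that] h(1)[OF that] r4[OF that]
    by (fastforce simp: L_def b_def A_def B_def split: if_splits)
  then have "c ` snd G \<subseteq> {..<K + m + 5}" using c(2) by fastforce
  from ocf_index_le[OF c(1) this] show ?thesis by simp
qed

section \<open>Exponential moments and degree tails in the binomial random graph\<close>

lemma set_pmf_gnp:
  assumes "G \<in> set_pmf (gnp n p)"
  shows "fst G = {..<n}" "snd G \<subseteq> all_edges {..<n}"
  using assms by (auto simp: gnp_def)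

lemma finite_all_edges: "finite V \<Longrightarrow> finite (all_edges V)"
  by (rule finite_subset[of _ "Pow V"]) (auto simp: all_edges_def)

lemma finite_set_pmf_gnp: "finite (set_pmf (gnp n p))"
proof (rule finite_subset)
  show "set_pmf (gnp n p) \<subseteq> {{..<n}} \<times> Pow (all_edges {..<n})"
    using set_pmf_gnp[of _ n p] by (simp add: subset_iff mem_Times_iff)
qed (simp add: finite_all_edges)

text \<open>By independence the expectation is a product over the possible edges. Each edge of
  \<open>F\<close> contributes \<open>1 + p * (exp l - 1)\<close>, which
  \<open>1 + x \<le> exp x\<close> bounds.\<close>

lemma gnp_exponential_moment:
  assumes p: "0 \<le> p" "p \<le> 1" and F: "F \<subseteq> all_edges {..<n}"
  shows "measure_pmf.expectation (gnp n p) (\<lambda>G. exp (l * real (card (F \<inter> snd G))))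
    \<le> exp (real (card F) * p * (exp l - 1))"
proof -
  let ?A = "all_edges {..<n}"
  let ?f = "\<lambda>e b. if e \<in> F \<and> b then exp l else (1::real)"
  have finA: "finite ?A" by (simp add: finite_all_edges)
  have finF: "finite F" using finA F by (rule rev_finite_subset)
  have eq: "exp (l * real (card (F \<inter> {e \<in> ?A. b e}))) = (\<Prod>e\<in>?A. ?f e (b e))" for b
  proof -
    have "(\<Prod>e\<in>?A. ?f e (b e)) = (\<Prod>e\<in>F \<inter> {e \<in> ?A. b e}. exp l)"
      using finA by (intro prod.mono_neutral_cong_right) auto
    then show ?thesis by (simp add: exp_of_nat_mult mult.commute flip: exp_of_nat2_mult)
  qed
  have "measure_pmf.expectation (gnp n p) (\<lambda>G. exp (l * real (card (F \<inter> snd G))))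
    = measure_pmf.expectation (Pi_pmf ?A False (\<lambda>_. bernoulli_pmf p)) (\<lambda>b. \<Prod>e\<in>?A. ?f e (b e))"
    by (simp add: gnp_def eq)
  also have "\<dots> = (\<Prod>e\<in>?A. measure_pmf.expectation (bernoulli_pmf p) (?f e))"
    using finA by (intro expectation_prod_Pi_pmf) (auto intro: integrable_measure_pmf_finite)
  also have "\<dots> = (\<Prod>e\<in>?A. if e \<in> F then 1 + p * (exp l - 1) else 1)"
    using p by (intro prod.cong) (auto simp: algebra_simps)
  also have "\<dots> = (1 + p * (exp l - 1)) ^ card F"
    using finA F by (subst prod.If_cases) (auto simp: Int_absorb1)
  also have "\<dots> \<le> exp (p * (exp l - 1)) ^ card F"
  proof (rule power_mono)
    \<comment> \<open>For negative \<open>l\<close> the sign is not obvious; the expression is a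
      convex combination of 1 and \<open>exp l\<close>.\<close>
    have "1 + p * (exp l - 1) = (1 - p) + p * exp l" by (simp add: algebra_simps)
    also have "\<dots> \<ge> 0" using p by simp
    finally show "0 \<le> 1 + p * (exp l - 1)" .
  qed (rule exp_ge_add_one_self)
  also have "\<dots> = exp (real (card F) * p * (exp l - 1))"
    by (simp add: mult.assoc flip: exp_of_nat_mult)
  finally show ?thesis .
qed

text \<open>The sign of \<open>l\<close> decides between the upper and the lower tail.\<close>

lemma gnp_exponential_Markov:
  assumes "0 \<le> p" "p \<le> 1" "F \<subseteq> all_edges {..<n}"
  shows "measure_pmf.prob (gnp n p) {G. l * t \<le> l * real (card (F \<inter> snd G))}
    \<le> exp (real (card F) * p * (exp l - 1) - l * t)"
proof -
  have "measure_pmf.prob (gnp n p) {G. l * t \<le> l * real (card (F \<inter> snd G))}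
      = measure_pmf.prob (gnp n p) {G \<in> space (gnp n p). exp (l * t) \<le> exp (l * real (card (F \<inter> snd G)))}"
    by simp
  also have "\<dots> \<le> measure_pmf.expectation (gnp n p) (\<lambda>G. exp (l * real (card (F \<inter> snd G)))) / exp (l * t)"
    by (rule integral_Markov_inequality_measure[where A = "{}"])
       (auto intro: integrable_measure_pmf_finite finite_set_pmf_gnp)
  also have "\<dots> \<le> exp (real (card F) * p * (exp l - 1)) / exp (l * t)"
    by (intro divide_right_mono gnp_exponential_moment assms) auto
  finally show ?thesis by (simp add: exp_diff)
qed

text \<open>Neighbours of \<open>v\<close> in \<open>S\<close> correspond to the present edges of a
  star. Dropping \<open>v\<close> from \<open>S\<close> avoids the singleton \<open>{v, v}\<close>
  and loses nothing, as there are no loops.\<close>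

lemma card_star_Int:
  assumes "snd G \<subseteq> all_edges (fst G)" "S \<subseteq> fst G"
  shows "card ((\<lambda>u. {v, u}) ` (S - {v}) \<inter> snd G) = card (neighbours G v \<inter> S)"
proof -
  have "{v} \<notin> snd G" using assms by (auto simp: all_edges_def)
  then have "(\<lambda>u. {v, u}) ` (S - {v}) \<inter> snd G = (\<lambda>u. {v, u}) ` (neighbours G v \<inter> S)"
    using assms(2) by (auto simp: neighbours_def)
  moreover have "inj_on (\<lambda>u. {v, u}) (neighbours G v \<inter> S)"
    by (auto simp: inj_on_def doubleton_eq_iff)
  ultimately show ?thesis by (simp add: card_image)
qed

lemma gnp_neighbours_Markov:
  assumes p: "0 \<le> p" "p \<le> 1" and S: "S \<subseteq> {..<n}" and v: "v < n"
  shows "measure_pmf.prob (gnp n p) {G. l * t \<le> l * real (card (neighbours G v \<inter> S))}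
    \<le> exp (real (card (S - {v})) * p * (exp l - 1) - l * t)"
proof -
  define F where "F = (\<lambda>u. {v, u}) ` (S - {v})"
  have "card F = card (S - {v})"
    unfolding F_def by (intro card_image) (auto simp: inj_on_def doubleton_eq_iff)
  moreover have "F \<subseteq> all_edges {..<n}" using S v by (auto simp: F_def all_edges_def)
  \<comment> \<open>The two events agree only on genuine graphs over \<open>{..<n}\<close>, hence
    the comparison almost everywhere.\<close>
  moreover have "measure_pmf.prob (gnp n p) {G. l * t \<le> l * real (card (neighbours G v \<inter> S))}
    = measure_pmf.prob (gnp n p) {G. l * t \<le> l * real (card (F \<inter> snd G))}"
    using set_pmf_gnp[of _ n p] S
    by (intro measure_pmf.finite_measure_eq_AE) (auto simp: AE_measure_pmf_iff F_def card_star_Int)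
  ultimately show ?thesis using gnp_exponential_Markov[OF p, of F n l t] by simp
qed

text \<open>The exponential bound with \<open>l = -1\<close>, where
  \<open>exp (- 1) - 1 \<le> - 1 / 2\<close>.\<close>

lemma gnp_neighbours_lower_tail:
  assumes "0 \<le> p" "p \<le> 1" "S \<subseteq> {..<n}" "v < n" "v \<notin> S" "real s \<le> card S"
  shows "measure_pmf.prob (gnp n p) {G. real (card (neighbours G v \<inter> S)) < t} \<le> exp (t - s * p / 2)"
proof -
  have "exp (- 1 :: real) \<le> 1 / 2"
    using exp_ge_add_one_self[of 1] by (simp add: exp_minus field_simps)
  then have "real (card S) * p * (exp (- 1) - 1) \<le> real (card S) * p * (- 1 / 2)"
    using assms by (intro mult_left_mono) auto
  moreover have "s * p \<le> card S * p" using assms by (intro mult_right_mono) auto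
  ultimately have "real (card S) * p * (exp (- 1) - 1) + t \<le> t - s * p / 2" by linarith
  moreover have "measure_pmf.prob (gnp n p) {G. real (card (neighbours G v \<inter> S)) < t}
    \<le> measure_pmf.prob (gnp n p) {G. - 1 * t \<le> - 1 * real (card (neighbours G v \<inter> S))}"
    by (intro measure_pmf.finite_measure_mono) auto
  ultimately show ?thesis
    using gnp_neighbours_Markov[OF assms(1-4), of "- 1" t] assms(5)
    by (auto elim!: order_trans)
qed

text \<open>The exponential bound with \<open>l = 1\<close>, where
  \<open>exp 1 - 1 \<le> 2\<close>.\<close>

lemma gnp_neighbours_upper_tail:
  assumes "0 \<le> p" "p \<le> 1" "S \<subseteq> {..<n}" "v < n" "card S \<le> s"
  shows "measure_pmf.prob (gnp n p) {G. t \<le> real (card (neighbours G v \<inter> S))} \<le> exp (2 * s * p - t)"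
proof -
  have "card (S - {v}) \<le> s" using assms(5) card_Diff1_le[of S v] by linarith
  then have "real (card (S - {v})) * p * (exp 1 - 1) \<le> real s * p * 2"
    using assms exp_le by (intro mult_mono) auto
  then show ?thesis
    using gnp_neighbours_Markov[OF assms(1-4), of 1 t]
    by (auto elim!: order_trans)
qed

section \<open>The four parts and the typical properties of their degrees\<close>

text \<open>The odd parts come first, so that together they form the initial segment
  \<open>{..<2 * s}\<close>; part 2 takes all vertices from \<open>3 * s\<close> on.\<close>

definition part :: "nat \<Rightarrow> nat \<Rightarrow> nat" where
  "part s v = (if v < s then 1 else if v < 2 * s then 3 else if v < 3 * s then 0 else 2)"

definition good :: "nat \<Rightarrow> real \<Rightarrow> real \<Rightarrow> nat ugraph \<Rightarrow> bool" where
  "good s t T G \<longleftrightarrow> snd G \<subseteq> all_edges (fst G) \<and>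
     (\<forall>v\<in>fst G. t \<le> real (card {u \<in> neighbours G v. part s u = (part s v + 1) mod 4})) \<and>
     (\<forall>v\<in>fst G. real (card {u \<in> neighbours G v. odd (part s u)}) < T)"

text \<open>A union bound over the vertices: the first term is the lower tail into the next part, of
  size at least \<open>s\<close>, and the second is the upper tail into the \<open>2 * s\<close>
  vertices of odd index.\<close>

lemma gnp_good:
  assumes p: "0 \<le> p" "p \<le> 1" and s: "4 * s \<le> n"
  shows "measure_pmf.prob (gnp n p) {G. \<not> (fst G = {..<n} \<and> good s t T G)}
    \<le> n * exp (t - s * p / 2) + n * exp (4 * s * p - T)"
proof -
  let ?P = "measure_pmf.prob (gnp n p)"
  define S where "S v = {u. u < n \<and> part s u = (part s v + 1) mod 4}" for v
  let ?A = "\<lambda>v. {G. real (card (neighbours G v \<inter> S v)) < t}"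
  let ?B = "\<lambda>v. {G. T \<le> real (card (neighbours G v \<inter> {..<2 * s}))}"
  have cardS: "s \<le> card (S v)" for v
  proof -
    \<comment> \<open>The witnesses are the starts of parts 1, 3, 0 and 2; the last block fits
      because \<open>4 * s \<le> n\<close>.\<close>
    have "\<exists>a. {a..<a + s} \<subseteq> S v"
      using s by (auto simp: S_def part_def
        intro: exI[of _ 0] exI[of _ s] exI[of _ "2 * s"] exI[of _ "3 * s"])
    then obtain a where "{a..<a + s} \<subseteq> S v" ..
    moreover have "finite (S v)" by (auto simp: S_def)
    ultimately have "card {a..<a + s} \<le> card (S v)" by (intro card_mono)
    then show ?thesis by simp
  qed
  have "?P {G. \<not> (fst G = {..<n} \<and> good s t T G)} \<le> ?P ((\<Union>v<n. ?A v) \<union> (\<Union>v<n. ?B v))"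
  proof (rule measure_pmf.finite_measure_mono_AE)
    have "\<exists>v<n. G \<in> ?A v \<or> G \<in> ?B v"
      if G: "G \<in> set_pmf (gnp n p)" and bad: "\<not> good s t T G" for G
    proof -
      have "neighbours G v \<inter> S v = {u \<in> neighbours G v. part s u = (part s v + 1) mod 4}"
        "neighbours G v \<inter> {..<2 * s} = {u \<in> neighbours G v. odd (part s u)}" for v
        using set_pmf_gnp[OF G] s by (auto simp: neighbours_def S_def part_def split: if_splits)
      then show ?thesis using bad set_pmf_gnp[OF G] by (auto simp: good_def not_le not_less)
    qed
    then show "AE G in gnp n p. G \<in> {G. \<not> (fst G = {..<n} \<and> good s t T G)} \<longrightarrow>
        G \<in> (\<Union>v<n. ?A v) \<union> (\<Union>v<n. ?B v)"
      using set_pmf_gnp[of _ n p] by (fastforce simp: AE_measure_pmf_iff)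
  qed simp
  also have "\<dots> \<le> ?P (\<Union>v<n. ?A v) + ?P (\<Union>v<n. ?B v)"
    by (rule measure_Un_le) auto
  also have "?P (\<Union>v<n. ?A v) \<le> (\<Sum>v<n. ?P (?A v))"
    by (rule measure_pmf.finite_measure_subadditive_finite) auto
  also have "\<dots> \<le> (\<Sum>v<n. exp (t - s * p / 2))"
  proof (rule sum_mono)
    fix v assume "v \<in> {..<n}"
    moreover have "v \<notin> S v" by (auto simp: S_def part_def)
    ultimately show "?P (?A v) \<le> exp (t - s * p / 2)"
      using p cardS[of v] by (intro gnp_neighbours_lower_tail) (auto simp: S_def)
  qed
  also have "?P (\<Union>v<n. ?B v) \<le> (\<Sum>v<n. ?P (?B v))"
    by (rule measure_pmf.finite_measure_subadditive_finite) auto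
  also have "\<dots> \<le> (\<Sum>v<n. exp (2 * real (2 * s) * p - T))"
    using p s by (intro sum_mono gnp_neighbours_upper_tail) auto
  finally show ?thesis by simp
qed


text \<open>The index bound uses \<open>k + 1\<close> even bits, where
  \<open>2 ^ k \<le> \<Delta> < 2 ^ (k + 1)\<close>. The degree bound is a double count: each vertex
  of part 2 has a neighbour among the \<open>s\<close> vertices of part 3, so
  \<open>n - 3 * s \<le> s * \<Delta>\<close>.\<close>

lemma good_bounds:
  assumes good: "good s t (2 ^ m) G" and G: "fst G = {..<n}"
    and s: "1 \<le> s" "4 * s \<le> n" and t: "log 2 n + 2 \<le> t" "real m + 1 \<le> t"
  shows "real (ocf_index G) \<le> log 2 (real (max_degree G)) + m + 6"
    and "real n / s - 3 \<le> max_degree G"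
proof -
  let ?\<Delta> = "max_degree G"
  have E: "snd G \<subseteq> all_edges (fst G)" and fin: "finite (fst G)"
    and many: "\<And>v. v \<in> fst G \<Longrightarrow> t \<le> card {u \<in> neighbours G v. part s u = (part s v + 1) mod 4}"
    and few: "\<And>v. v \<in> fst G \<Longrightarrow> real (card {u \<in> neighbours G v. odd (part s u)}) < 2 ^ m"
    using good G by (auto simp: good_def)
  have deg: "card (neighbours G v) \<le> ?\<Delta>" if "v \<in> fst G" for v
    using card_neighbours_le_max_degree[OF E fin that] .
  have "{3 * s..<n} \<subseteq> (\<Union>y\<in>{s..<2 * s}. neighbours G y)"
  proof
    fix v assume v: "v \<in> {3 * s..<n}"
    then have "t \<le> card {u \<in> neighbours G v. part s u = 3}"
      using many[of v] G by (simp add: part_def)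
    then have "{u \<in> neighbours G v. part s u = 3} \<noteq> {}" 
      using t by (metis card.empty of_nat_0 add_nonneg_pos not_le of_nat_0_le_iff order_trans
        zero_less_one)
    then obtain u where u: "u \<in> neighbours G v" "part s u = 3" by blast
    then have "v \<in> neighbours G u" using v G by (simp add: neighbours_def insert_commute)
    moreover have "u \<in> {s..<2 * s}" using u(2) by (auto simp: part_def split: if_splits)
    ultimately show "v \<in> (\<Union>y\<in>{s..<2 * s}. neighbours G y)" by blast
  qed
  moreover have "finite (neighbours G y)" for y using fin by (simp add: neighbours_def)
  ultimately have "card {3 * s..<n} \<le> card (\<Union>y\<in>{s..<2 * s}. neighbours G y)"
    by (intro card_mono) auto
  also have "\<dots> \<le> (\<Sum>y\<in>{s..<2 * s}. card (neighbours G y))" by (intro card_UN_le) auto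
  also have "\<dots> \<le> (\<Sum>y\<in>{s..<2 * s}. ?\<Delta>)" using deg G s by (intro sum_mono) auto
  finally have le: "n \<le> s * ?\<Delta> + 3 * s" by simp
  then have "real n \<le> (?\<Delta> + 3) * s"
    by (metis add_mult_distrib mult.commute of_nat_le_iff of_nat_mult)
  then show "real n / s - 3 \<le> ?\<Delta>" using s by (simp add: field_simps)
  have "s \<le> s * ?\<Delta>" using le s by linarith
  then have \<Delta>: "1 \<le> ?\<Delta>" using s by (cases ?\<Delta>) auto
  obtain k where k: "2 ^ k \<le> ?\<Delta>" "?\<Delta> < 2 ^ (k + 1)"
    using ex_power_ivl1[OF order_refl \<Delta>] by auto
  have "?\<Delta> \<le> n" using max_degree_le_card[OF E fin] G s by (cases n) auto
  have kl: "real k \<le> log 2 ?\<Delta>" using k(1) by (intro le_log_of_power) (simp_all add: numeral_power_le_of_nat_cancel_iff)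
  also have "\<dots> \<le> log 2 n" using \<Delta> \<open>?\<Delta> \<le> n\<close> by simp
  finally have kt: "real (max (k + 1) m + 1) \<le> t" using t by (simp add: max_def)
  have "ocf_index G \<le> (k + 1) + m + 5"
  proof (rule ocf_index_le_of_cyclic_partition[OF E fin, of "part s"])
    fix v assume v: "v \<in> fst G"
    show "part s v < 4" by (simp add: part_def)
    show "max (k + 1) m + 1 \<le> card {u \<in> neighbours G v. part s u = (part s v + 1) mod 4}"
      using order_trans[OF kt many[OF v]] by linarith
    have "card {u \<in> neighbours G v. even (part s u)} \<le> card (neighbours G v)"
      using fin by (intro card_mono) (auto simp: neighbours_def)
    then show "card {u \<in> neighbours G v. even (part s u)} < 2 ^ (k + 1)"
      using deg[OF v] k(2) by linarith
    show "card {u \<in> neighbours G v. odd (part s u)} < 2 ^ m"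
      using few[OF v] by (simp add: of_nat_less_numeral_power_cancel_iff)
  qed
  then show "real (ocf_index G) \<le> log 2 ?\<Delta> + m + 6" using kl by linarith
qed

section \<open>Asymptotic estimates and choice of parameters\<close>

lemma log2_le:
  assumes "1 \<le> x"
  shows "log 2 x \<le> 3 / 2 * ln x"
proof -
  have "2 / 3 * ln x \<le> ln 2 * ln x"
    using assms ln2_ge_two_thirds by (intro mult_right_mono) auto
  then show ?thesis by (simp add: log_def field_simps)
qed

text \<open>This makes the relative error \<open>o(1)\<close>. It combines
  \<open>ln (ln x) \<le> 2 * sqrt (ln x)\<close> with \<open>ln x \<le> log 2 x\<close>; the lower
  bound \<open>a\<close> will not depend on the random graph, so neither will the error
  bound.\<close>

lemma ln_ln_over_log2_bounds:
  assumes "1 \<le> a" "a \<le> ln x" "0 < x"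
  shows "\<bar>4 * ln (ln x) / log 2 x\<bar> \<le> 8 / sqrt a"
proof -
  have ln: "1 \<le> ln x" using assms by linarith
  then have "ln (ln x) = 2 * ln (sqrt (ln x))" by (simp add: ln_sqrt)
  also have "\<dots> \<le> 2 * sqrt (ln x)" using ln ln_bound[of "sqrt (ln x)"] by simp
  finally have 1: "4 * ln (ln x) \<le> 8 * sqrt (ln x)" by simp
  have "ln 2 * ln x \<le> 1 * ln x" using ln ln_le_minus_one[of 2] by (intro mult_right_mono) auto
  then have 2: "ln x \<le> log 2 x" by (simp add: log_def field_simps)
  have "4 * ln (ln x) / log 2 x \<le> 8 * sqrt (ln x) / ln x"
    using 1 2 ln by (intro frac_le) auto
  also have "\<dots> = 8 / sqrt (ln x)" using ln by (simp add: real_div_sqrt field_simps)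
  also have "\<dots> \<le> 8 / sqrt a"
  proof (rule divide_left_mono)
    have "0 < sqrt a" "0 < sqrt (ln x)" using assms ln by (simp_all only: real_sqrt_gt_0_iff)
    then show "0 < sqrt (ln x) * sqrt a" by (intro mult_pos_pos)
  qed (use assms in auto)
  finally show ?thesis using ln 2 by simp
qed

theorem theorem15:
  fixes \<epsilon> :: real
  assumes "0 < \<epsilon>" and "\<epsilon> < 1"
  shows "\<exists>C::real. \<forall>p :: nat \<Rightarrow> real.
    (\<forall>n. 0 \<le> p n \<and> p n \<le> 1) \<longrightarrow> p \<in> \<omega>(\<lambda>n. real n powr (- \<epsilon>)) \<longrightarrow>
    (\<exists>\<eta> :: nat \<Rightarrow> real. \<eta> \<longlonglongrightarrow> 0 \<and>
      asymp_almost_surely (\<lambda>n. gnp n (p n)) (\<lambda>n G.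
        real (ocf_index G) \<le>
          log 2 (real (max_degree G)) + C * ln (ln (real (max_degree G))) \<and>
        (\<exists>h. \<bar>h\<bar> \<le> \<eta> n \<and>
          log 2 (real (max_degree G)) + C * ln (ln (real (max_degree G))) =
            (1 + h) * log 2 (real (max_degree G)))))"
proof (rule exI[of _ 4], intro allI impI)
  \<comment> \<open>The constant 4: the surplus over \<open>log 2 \<Delta>\<close> is at most
    \<open>m n + 6 \<le> 10 + 3 * ln (ln n)\<close>, as \<open>2 * log 2 l \<le> 3 * ln l\<close>.
    The gap between 3 and 4 absorbs the 10 and the passage from \<open>ln n\<close> to
    \<open>\<delta> * ln n\<close>.\<close>
  fix p :: "nat \<Rightarrow> real"
  assume p: "\<forall>n. 0 \<le> p n \<and> p n \<le> 1" and p\<omega>: "p \<in> \<omega>(\<lambda>n. real n powr (- \<epsilon>))"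
  \<comment> \<open>Up to logarithms \<open>\<Delta>\<close> is at least
    \<open>n powr (1 - \<epsilon>)\<close>; halving the exponent absorbs the factor
    \<open>(ln n)\<^sup>2\<close> and additive constants.\<close>
  define \<delta> where "\<delta> = (1 - \<epsilon>) / 2"
  have \<delta>: "0 < \<delta>" "2 * \<delta> < 1" and \<epsilon>: "\<epsilon> = 1 - 2 * \<delta>"
    using assms by (auto simp: \<delta>_def field_simps)
  \<comment> \<open>With \<open>l = ln n\<close>, \<open>s * p\<close> lies between
    \<open>l\<^sup>2\<close> and \<open>l\<^sup>2 + 1\<close>, so the lower tail beats the union
    bound. The choice of \<open>m\<close> gives \<open>2 ^ m \<ge> 8 * l\<^sup>2\<close>, twice the
    main term \<open>4 * l\<^sup>2\<close> of the upper tail exponent. These two tails form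
    \<open>err\<close>.\<close>
  define s where "s n = nat \<lceil>(ln (real n))\<^sup>2 / p n\<rceil>" for n
  define m where "m n = nat \<lceil>log 2 (8 * (ln (real n))\<^sup>2)\<rceil>" for n
  define t where "t n = 3 * ln (real n)" for n
  define \<eta> where "\<eta> n = 8 / sqrt (\<delta> * ln (real n))" for n
  define err where "err n = real n * exp (3 * ln (real n) - (ln (real n))\<^sup>2 / 2)
    + real n * exp (4 - 4 * (ln (real n))\<^sup>2)" for n
  let ?Q = "\<lambda>n G. real (ocf_index G) \<le>
          log 2 (real (max_degree G)) + 4 * ln (ln (real (max_degree G))) \<and>
        (\<exists>h. \<bar>h\<bar> \<le> \<eta> n \<and>
          log 2 (real (max_degree G)) + 4 * ln (ln (real (max_degree G))) =
            (1 + h) * log 2 (real (max_degree G)))"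
  have ev_real: "eventually (\<lambda>n. P (real n)) sequentially" if "eventually P at_top" for P
    using that filterlim_real_sequentially by (simp add: filterlim_iff)
  have ev_p: "\<forall>\<^sub>F n in sequentially. real n powr (- \<epsilon>) \<le> p n"
    using landau_omega.smallD[OF p\<omega>, of 1] p by simp
  \<comment> \<open>The six estimates yield in turn \<open>4 * s \<le> n\<close>,
    \<open>n powr \<delta> \<le> \<Delta>\<close>, \<open>log 2 n + 2 \<le> t\<close>,
    \<open>m + 1 \<le> t\<close>, the bound on the surplus \<open>m + 6\<close>, and
    \<open>1 \<le> \<delta> * ln n\<close>.\<close>
  have "\<forall>\<^sub>F x::real in at_top. 4 * ((ln x)\<^sup>2 * x powr \<epsilon> + 1) \<le> x"
    using assms by real_asymp
  note ev1 = ev_real[OF this]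
  have "\<forall>\<^sub>F x::real in at_top. x powr \<delta> \<le> x / ((ln x)\<^sup>2 * x powr \<epsilon> + 1) - 3"
    unfolding \<epsilon> using \<delta> by real_asymp
  note ev2 = ev_real[OF this]
  have "\<forall>\<^sub>F x::real in at_top. 3 / 2 * ln x + 2 \<le> 3 * ln x"
    by real_asymp
  note ev3 = ev_real[OF this]
  have "\<forall>\<^sub>F x::real in at_top. 5 + 3 * ln (ln x) \<le> 3 * ln x"
    by real_asymp
  note ev4 = ev_real[OF this]
  have "\<forall>\<^sub>F x::real in at_top. 10 + 3 * ln (ln x) \<le> 4 * ln (\<delta> * ln x)"
    using \<delta> by real_asymp
  note ev5 = ev_real[OF this]
  have "\<forall>\<^sub>F x::real in at_top. 1 \<le> \<delta> * ln x"
    using \<delta> by real_asymp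
  note ev6 = ev_real[OF this]
  have lower: "\<forall>\<^sub>F n in sequentially. 1 - err n \<le> measure_pmf.prob (gnp n (p n)) {G. ?Q n G}"
    using ev_p ev1 ev2 ev3 ev4 ev5 ev6
  proof eventually_elim
    case (elim n)
    define l where "l = ln (real n)"
    have "l > 0" using elim(7) \<delta> by (metis l_def less_le_trans zero_less_mult_pos zero_less_one)
    \<comment> \<open>The value \<open>n = 0\<close> is excluded because
      \<open>ln 0 = 0\<close>.\<close>
    then have "n > 0" by (cases n) (auto simp: l_def)
    have "\<delta> * l \<le> 1 * l" using \<delta> \<open>l > 0\<close> by (intro mult_right_mono) auto
    then have l: "1 \<le> l" using elim(7) by (simp add: l_def)
    have pn: "0 < p n" using elim(1) \<open>n > 0\<close> by (simp add: less_le_trans[OF _ elim(1)])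
    have s_lower: "l\<^sup>2 / p n \<le> s n" and s_upper: "s n \<le> l\<^sup>2 / p n + 1"
      using pn by (simp_all add: s_def l_def real_nat_ceiling_ge of_nat_ceiling)
    have sp: "l\<^sup>2 \<le> s n * p n" "s n * p n \<le> l\<^sup>2 + 1"
    proof -
      show "l\<^sup>2 \<le> s n * p n" using s_lower pn by (simp add: field_simps)
      have "s n * p n \<le> (l\<^sup>2 / p n + 1) * p n" using s_upper pn by (intro mult_right_mono) auto
      also have "\<dots> = l\<^sup>2 + p n" using pn by (simp add: field_simps)
      also have "\<dots> \<le> l\<^sup>2 + 1" using p by simp
      finally show "s n * p n \<le> l\<^sup>2 + 1" .
    qed
    have "l\<^sup>2 / p n \<le> l\<^sup>2 / real n powr (- \<epsilon>)"
      using elim(1) pn \<open>n > 0\<close> by (intro divide_left_mono) auto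
    then have s_le: "real (s n) \<le> l\<^sup>2 * real n powr \<epsilon> + 1"
      using s_upper by (simp add: powr_minus field_simps)
    then have s4: "4 * s n \<le> n" using elim(2) by (simp add: l_def)
    have "0 < l\<^sup>2 / p n" using l pn by simp
    then have s1: "1 \<le> s n" using s_lower by linarith
    have l1: "1 \<le> l\<^sup>2" using l by simp
    have loglog: "log 2 (8 * l\<^sup>2) \<le> 3 + 3 * ln l"
    proof -
      have "log 2 (8 * l\<^sup>2) = log 2 (2 ^ 3) + 2 * log 2 l"
        using l by (simp add: log_mult log_nat_power)
      also have "log 2 (2 ^ 3 :: real) = 3" by (subst log_nat_power) auto
      finally show ?thesis using log2_le[OF l] by simp
    qed
    have "0 \<le> log 2 (8 * l\<^sup>2)" using l1 by (intro zero_le_log_cancel_iff[THEN iffD2]) linarith+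
    then have m_upper: "real (m n) \<le> log 2 (8 * l\<^sup>2) + 1"
      unfolding m_def l_def[symmetric] by linarith
    have "log 2 (8 * l\<^sup>2) \<le> m n" by (simp add: m_def l_def real_nat_ceiling_ge)
    then have "8 * l\<^sup>2 \<le> 2 powr m n"
      using l1 by (intro log_le_iff[THEN iffD1]) auto
    then have m_lower: "8 * l\<^sup>2 \<le> 2 ^ m n" by (simp add: powr_realpow)
    have t_log: "log 2 n + 2 \<le> t n"
      using log2_le[of n] \<open>n > 0\<close> elim(4) by (simp add: t_def)
    have t_m: "real (m n) + 1 \<le> t n"
      using m_upper loglog elim(5) by (simp add: t_def l_def)
    have Q: "?Q n G" if G: "fst G = {..<n}" "good (s n) (t n) (2 ^ m n) G" for G
    proof -
      let ?\<Delta> = "real (max_degree G)"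
      note bounds = good_bounds[OF G(2,1) s1 s4 t_log t_m]
      have "real n powr \<delta> \<le> real n / (l\<^sup>2 * real n powr \<epsilon> + 1) - 3"
        using elim(3) by (simp add: l_def)
      also have "\<dots> \<le> real n / s n - 3"
        using s_le s1 by (intro diff_mono divide_left_mono mult_pos_pos) auto
      also have "\<dots> \<le> ?\<Delta>" by (rule bounds)
      finally have \<Delta>: "real n powr \<delta> \<le> ?\<Delta>" .
      moreover have "0 < real n powr \<delta>" using \<open>n > 0\<close> by simp
      ultimately have "0 < ?\<Delta>" by linarith
      have "ln (real n powr \<delta>) \<le> ln ?\<Delta>" using \<Delta> \<open>n > 0\<close> \<open>0 < ?\<Delta>\<close> by (subst ln_le_cancel_iff) auto
      then have ln\<Delta>: "\<delta> * l \<le> ln ?\<Delta>" using \<open>n > 0\<close> by (simp add: ln_powr l_def)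
      have \<delta>l: "1 \<le> \<delta> * l" using elim(7) by (simp add: l_def)
      have "real (m n) + 6 \<le> 4 * ln (\<delta> * l)"
        using m_upper loglog elim(6) by (simp add: l_def)
      also have "\<dots> \<le> 4 * ln (ln ?\<Delta>)" using ln\<Delta> \<delta>l by simp
      finally have "real (ocf_index G) \<le> log 2 ?\<Delta> + 4 * ln (ln ?\<Delta>)"
        using bounds(1) by linarith
      \<comment> \<open>The witness for \<open>h\<close> is this quotient; its bound is uniform over
        good graphs because \<open>ln \<Delta> \<ge> \<delta> * ln n\<close>.\<close>
      moreover have "\<bar>4 * ln (ln ?\<Delta>) / log 2 ?\<Delta>\<bar> \<le> \<eta> n"
        unfolding \<eta>_def l_def[symmetric]
        by (rule ln_ln_over_log2_bounds) (use \<delta>l ln\<Delta> \<open>0 < ?\<Delta>\<close> in auto)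
      moreover have "log 2 ?\<Delta> \<noteq> 0" using ln\<Delta> \<delta>l by (auto simp: log_def)
      then have "log 2 ?\<Delta> + 4 * ln (ln ?\<Delta>) = (1 + 4 * ln (ln ?\<Delta>) / log 2 ?\<Delta>) * log 2 ?\<Delta>"
        by (simp add: field_simps)
      ultimately show ?thesis by blast
    qed
    let ?P = "measure_pmf.prob (gnp n (p n))"
    have "?P {G. \<not> ?Q n G} \<le> ?P {G. \<not> (fst G = {..<n} \<and> good (s n) (t n) (2 ^ m n) G)}"
      using Q by (intro measure_pmf.finite_measure_mono) auto
    also have "\<dots> \<le> n * exp (t n - s n * p n / 2) + n * exp (4 * s n * p n - 2 ^ m n)"
      using gnp_good[OF _ _ s4] p by auto
    also have "\<dots> \<le> err n"
      unfolding err_def l_def[symmetric] t_def using sp m_lower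
      by (intro add_mono mult_left_mono) (auto simp: l_def[symmetric])
    finally have "?P {G. \<not> ?Q n G} \<le> err n" .
    moreover have eq: "{G. \<not> ?Q n G} = space (gnp n (p n)) - {G. ?Q n G}" by auto
    have "?P {G. \<not> ?Q n G} = 1 - ?P {G. ?Q n G}"
      using measure_pmf.prob_compl[of "{G. ?Q n G}" "gnp n (p n)"]
      by (simp only: eq sets_measure_pmf UNIV_I)
    ultimately show ?case by linarith
  qed
  \<comment> \<open>Both terms of \<open>err\<close> vanish, since a negative multiple of
    \<open>(ln n)\<^sup>2\<close> in the exponent outweighs every multiple of
    \<open>ln n\<close>.\<close>
  have lim: "(\<lambda>n. 1 - err n) \<longlonglongrightarrow> 1"
    unfolding err_def by real_asymp
  have "asymp_almost_surely (\<lambda>n. gnp n (p n)) ?Q"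
    unfolding asymp_almost_surely_def
    by (rule tendsto_sandwich[OF lower _ lim tendsto_const]) simp
  moreover have "\<eta> \<longlonglongrightarrow> 0"
    unfolding \<eta>_def using \<delta>(1) by real_asymp
  ultimately show "\<exists>\<eta> :: nat \<Rightarrow> real. \<eta> \<longlonglongrightarrow> 0 \<and>
      asymp_almost_surely (\<lambda>n. gnp n (p n)) (\<lambda>n G.
        real (ocf_index G) \<le>
          log 2 (real (max_degree G)) + 4 * ln (ln (real (max_degree G))) \<and>
        (\<exists>h. \<bar>h\<bar> \<le> \<eta> n \<and>
          log 2 (real (max_degree G)) + 4 * ln (ln (real (max_degree G))) =
            (1 + h) * log 2 (real (max_degree G))))"
    by blast
qed

end
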